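(* Let $F:\mathbb{R}^d\to\mathbb{R}$, $F(w)=f(w)+g(w)$, with $f,g$ twice differentiable. Suppose $F$ satisfies $\mu$-PL, is twice differentiable, $L$-smooth, and has $L_H$-Lipschitz Hessian. Let $w_*$ be a global minimizer of $F$. Assume that $f$ is $2\lambda_*$-strongly convex for some $\lambda_*>0$. If the average Hessian of the possibly non-convex $g$ between $w$ and $w_*$ satisfies $\lambda_{\min}(H_g(w))\ge-\lambda_*$, then $F$ satisfies $\lambda_*$-average out with respect to $w_*$ at $w$, i.e. $\lambda_{\min}(H_F(w))\ge\lambda_*>0$.
   Context: For a twice differentiable function $h$, the average Hessian at $w$ (towards $w_*$) is $H_h(w):=\int_0^1\nabla^2h(\theta w+(1-\theta)w_* )\,d\theta$. $\mu$-PL (Polyak-Łojasiewicz): $\|\nabla F(w)\|^2\ge2\mu(F(w)-\min F)$ for all $w$. $L$-smooth: the gradient is $L$-Lipschitz in the Euclidean norm. $L_H$-Lipschitz Hessian: $\|\nabla^2F(x)-\nabla^2F(y)\|_2\le L_H\|x-y\|_2$ for all $x,y$. $\nu$-strongly convex: $f(x)\ge f(y)+\langle\nabla f(y),x-y\rangle+\frac{\nu}{2}\|x-y\|^2$ for all $x,y$. *)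

theory Defs
  imports "HOL-Analysis.Analysis"
begin

definition gradient :: "(real ^ 'n \<Rightarrow> real) \<Rightarrow> real ^ 'n \<Rightarrow> real ^ 'n" where
  "gradient h x = (THE D. GDERIV h x :> D)"

text \<open>No continuity of the second derivatives is required: a function is twice differentiable
  if it is Frechet differentiable everywhere and so is its gradient.\<close>

definition twice_differentiable :: "(real ^ 'n \<Rightarrow> real) \<Rightarrow> bool" where
  "twice_differentiable h \<longleftrightarrow>
     (\<forall>x. h differentiable (at x)) \<and> (\<forall>x. gradient h differentiable (at x))"

definition hessian :: "(real ^ 'n \<Rightarrow> real) \<Rightarrow> real ^ 'n \<Rightarrow> real ^ 'n ^ 'n" where
  "hessian h x = jacobian (gradient h) (at x)"

text \<open>The integral is the Henstock-Kurzweil integral of a matrix-valued function. It has the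
  dummy value \<open>0\<close> if the integrand is not integrable on the segment, so hypotheses on
  \<open>avg_hessian\<close> should be accompanied by \<open>avg_hessian_exists\<close>.\<close>

definition avg_hessian_exists ::
    "(real ^ 'n \<Rightarrow> real) \<Rightarrow> real ^ 'n \<Rightarrow> real ^ 'n \<Rightarrow> bool" where
  "avg_hessian_exists h ws w \<longleftrightarrow>
     (\<lambda>\<theta>. hessian h (\<theta> *\<^sub>R w + (1 - \<theta>) *\<^sub>R ws)) integrable_on {0..1}"

definition avg_hessian ::
    "(real ^ 'n \<Rightarrow> real) \<Rightarrow> real ^ 'n \<Rightarrow> real ^ 'n \<Rightarrow> real ^ 'n ^ 'n" where
  "avg_hessian h ws w =
     integral {0..1} (\<lambda>\<theta>. hessian h (\<theta> *\<^sub>R w + (1 - \<theta>) *\<^sub>R ws))"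

definition real_eigenvalues :: "real ^ 'n ^ 'n \<Rightarrow> real set" where
  "real_eigenvalues A = {l. \<exists>v. v \<noteq> 0 \<and> A *v v = l *\<^sub>R v}"

text \<open>Intended for symmetric matrices, whose set of real eigenvalues is finite and nonempty.\<close>

definition lambda_min :: "real ^ 'n ^ 'n \<Rightarrow> real" where
  "lambda_min A = Min (real_eigenvalues A)"

definition PL :: "real \<Rightarrow> (real ^ 'n \<Rightarrow> real) \<Rightarrow> bool" where
  "PL \<mu> F \<longleftrightarrow>
     (\<exists>m. is_arg_min F (\<lambda>_. True) m \<and>
        (\<forall>w. (norm (gradient F w))\<^sup>2 \<ge> 2 * \<mu> * (F w - F m)))"

definition L_smooth :: "real \<Rightarrow> (real ^ 'n \<Rightarrow> real) \<Rightarrow> bool" where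
  "L_smooth L F \<longleftrightarrow> L-lipschitz_on UNIV (gradient F)"

text \<open>\<open>onorm\<close> of the induced linear map is the spectral norm of the matrix.\<close>

definition lipschitz_hessian :: "real \<Rightarrow> (real ^ 'n \<Rightarrow> real) \<Rightarrow> bool" where
  "lipschitz_hessian L F \<longleftrightarrow>
     (\<forall>x y. onorm (\<lambda>v. (hessian F x - hessian F y) *v v) \<le> L * norm (x - y))"

definition strongly_convex :: "real \<Rightarrow> (real ^ 'n \<Rightarrow> real) \<Rightarrow> bool" where
  "strongly_convex \<nu> f \<longleftrightarrow>
     (\<forall>x y. f x \<ge> f y + gradient f y \<bullet> (x - y) + \<nu> / 2 * (norm (x - y))\<^sup>2)"

text \<open>The average Hessian of \<open>F\<close> between \<open>ws\<close> and \<open>w\<close> is bounded below by \<open>\<nu> > 0\<close>; this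
  forces the averaged Hessian to exist, since the zero matrix has smallest eigenvalue \<open>0\<close>.\<close>

definition average_out ::
    "real \<Rightarrow> (real ^ 'n \<Rightarrow> real) \<Rightarrow> real ^ 'n \<Rightarrow> real ^ 'n \<Rightarrow> bool" where
  "average_out \<nu> F ws w \<longleftrightarrow> lambda_min (avg_hessian F ws w) \<ge> \<nu> \<and> \<nu> > 0"

end

theory Submission
  imports Defs
begin

text \<open>For a symmetric matrix \<open>A\<close>, the smallest eigenvalue is the minimum of the quadratic form
  \<open>v \<bullet> (A *v v)\<close> on the unit sphere, so \<open>lambda_min A \<ge> c\<close> says precisely that
  \<open>v \<bullet> (A *v v) \<ge> c * (v \<bullet> v)\<close> for all \<open>v\<close> (lemma \<open>lambda_min_ge_iff\<close>). In this form lower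
  bounds add up and survive integration. Strong convexity of \<open>f\<close> bounds the quadratic form of
  every Hessian of \<open>f\<close> below by \<open>2 * lam\<close>, hence also that of the average Hessian of \<open>f\<close>; the
  hypothesis on \<open>g\<close> contributes \<open>- lam\<close>; and the average Hessian of \<open>F\<close> is the sum of the two.

  Two points need care because the Hessians of \<open>f\<close> and \<open>g\<close> need not be continuous. First, they
  are nevertheless symmetric: for this it suffices that the gradient is differentiable at the
  point in question (lemma \<open>gradient_derivative_symmetric\<close>). Second, the average Hessian of \<open>f\<close>
  exists because the Hessian of \<open>f\<close> is the difference of that of \<open>F\<close>, which is continuous by the
  Lipschitz condition, and that of \<open>g\<close>, which is integrable on the segment by assumption.\<close>

section \<open>Gradients and Hessians\<close>

lemma gradient_eqI:
  assumes "GDERIV h x :> D"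
  shows "gradient h x = D"
proof -
  have "E = D" if "GDERIV h x :> E" for E
  proof -
    have "(\<lambda>k. k \<bullet> E) = (\<lambda>k. k \<bullet> D)"
      using that assms unfolding gderiv_def by (rule has_derivative_unique)
    then have "\<forall>k. k \<bullet> E = k \<bullet> D"
      by (simp add: fun_eq_iff)
    then show ?thesis
      by (simp only: vector_eq_ldot)
  qed
  then show ?thesis
    unfolding gradient_def using assms by (rule the_equality[rotated])
qed

lemma gradient_works:
  fixes h :: "real ^ 'n \<Rightarrow> real"
  assumes "h differentiable (at x)"
  shows "GDERIV h x :> gradient h x"
proof -
  obtain h' where h': "(h has_derivative h') (at x)"
    using assms by (auto simp: differentiable_def)
  then have lin: "linear h'"
    by (rule has_derivative_linear)
  have "h' = (\<lambda>k. k \<bullet> adjoint h' 1)"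
    using adjoint_works[OF lin, of _ 1] by (simp add: fun_eq_iff)
  with h' have "GDERIV h x :> adjoint h' 1"
    unfolding gderiv_def by simp
  then show ?thesis
    by (simp add: gradient_eqI)
qed

lemma hessian_works:
  assumes "twice_differentiable h"
  shows "(gradient h has_derivative (\<lambda>k. hessian h x *v k)) (at x)"
  using assms by (simp add: twice_differentiable_def hessian_def flip: jacobian_works)

lemma hessian_add:
  assumes f: "twice_differentiable f" and g: "twice_differentiable g"
  shows "hessian (\<lambda>x. f x + g x) x = hessian f x + hessian g x"
proof -
  have grad: "gradient (\<lambda>x. f x + g x) = (\<lambda>x. gradient f x + gradient g x)"
    using f g unfolding twice_differentiable_def
    by (intro ext gradient_eqI GDERIV_add gradient_works) auto
  have "(gradient (\<lambda>x. f x + g x) has_derivative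
      (\<lambda>k. (hessian f x + hessian g x) *v k)) (at x)"
    unfolding grad matrix_vector_mult_add_rdistrib
    by (intro has_derivative_add hessian_works f g)
  then have "frechet_derivative (gradient (\<lambda>x. f x + g x)) (at x) =
      (\<lambda>k. (hessian f x + hessian g x) *v k)"
    by (simp only: frechet_derivative_at[symmetric])
  then show ?thesis
    unfolding hessian_def[of "\<lambda>x. f x + g x"] jacobian_def by (simp add: matrix_of_matrix_vector_mul)
qed

section \<open>Symmetry of second derivatives\<close>

text \<open>The mean value theorem along \<open>u\<close> turns the second difference into a first difference of
  the gradient in direction \<open>v\<close>, and differentiability of the gradient at \<open>x\<close> evaluates that.
  The second difference is symmetric in \<open>u\<close> and \<open>v\<close>, whence the symmetry of the derivative.\<close>

lemma second_difference_tendsto: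
  fixes h :: "'a::real_inner \<Rightarrow> real"
  assumes G: "\<And>y. GDERIV h y :> G y" and G': "(G has_derivative G') (at x)"
  shows "((\<lambda>t. (h (x + t *\<^sub>R u + t *\<^sub>R v) - h (x + t *\<^sub>R u) - h (x + t *\<^sub>R v) + h x) / t\<^sup>2)
    \<longlongrightarrow> u \<bullet> G' v) (at_right 0)"
proof (rule tendstoI)
  fix e :: real assume "e > 0"
  interpret G': bounded_linear G'
    using G' by (rule has_derivative_bounded_linear)
  define K where "K = 1 + norm u + norm v"
  have K: "K > 0" "norm u \<le> K" "norm u + norm v \<le> K"
    unfolding K_def using norm_ge_zero[of u] norm_ge_zero[of v] by linarith+
  \<comment> \<open>The two remainders of the gradient contribute at most \<open>2 * e' * t * K\<close>, paired with a
    vector of norm at most \<open>K\<close>; this choice keeps the product below \<open>e * t\<close>.\<close>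
  define e' where "e' = e / (4 * K * K)"
  have e': "e' > 0"
    using \<open>e > 0\<close> K by (simp add: e'_def)
  obtain d where d: "d > 0"
    and rem: "\<And>k. norm k < d \<Longrightarrow> norm (G (x + k) - G x - G' k) \<le> e' * norm k"
    using G' e' unfolding has_derivative_at_alt by (metis add_diff_cancel_left')
  have "dist ((h (x + t *\<^sub>R u + t *\<^sub>R v) - h (x + t *\<^sub>R u) - h (x + t *\<^sub>R v) + h x) / t\<^sup>2)
      (u \<bullet> G' v) < e" if t: "0 < t" "t < d / K" for t
  proof -
    define \<phi> where "\<phi> s = h (x + s *\<^sub>R t *\<^sub>R u + t *\<^sub>R v) - h (x + s *\<^sub>R t *\<^sub>R u)" for s
    define R where "R k = G (x + k) - G x - G' k" for k
    have tK: "t * K < d"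
      using t K by (simp add: field_simps)
    have deriv: "DERIV \<phi> s :> (t *\<^sub>R u) \<bullet>
        (G (x + s *\<^sub>R t *\<^sub>R u + t *\<^sub>R v) - G (x + s *\<^sub>R t *\<^sub>R u))" for s
    proof -
      have "(\<phi> has_derivative (\<lambda>r. (r *\<^sub>R t *\<^sub>R u) \<bullet> G (x + s *\<^sub>R t *\<^sub>R u + t *\<^sub>R v)
          - (r *\<^sub>R t *\<^sub>R u) \<bullet> G (x + s *\<^sub>R t *\<^sub>R u))) (at s)"
        unfolding \<phi>_def
        by (intro has_derivative_diff
            has_derivative_compose[where g = h, OF _ G[unfolded gderiv_def]])
          (auto intro!: derivative_eq_intros)
      then show ?thesis
        unfolding has_field_derivative_def
        by (rule has_derivative_eq_rhs) (auto simp: algebra_simps inner_diff_right)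
    qed
    obtain s where s: "0 < s" "s < 1"
      and mvt: "\<phi> 1 - \<phi> 0 = (t *\<^sub>R u) \<bullet>
        (G (x + s *\<^sub>R t *\<^sub>R u + t *\<^sub>R v) - G (x + s *\<^sub>R t *\<^sub>R u))"
      using MVT2[of 0 1 \<phi>, OF _ deriv] by auto
    define a where "a = s *\<^sub>R t *\<^sub>R u"
    define b where "b = a + t *\<^sub>R v"
    have "norm a = s * t * norm u"
      using s t by (simp add: a_def)
    also have "\<dots> \<le> t * norm u"
      using s t mult_right_mono[of s 1 "t * norm u"] by (simp add: mult.assoc)
    finally have a: "norm a \<le> t * norm u" .
    have "norm b \<le> norm a + t * norm v"
      unfolding b_def using t norm_triangle_ineq[of a "t *\<^sub>R v"] by simp
    also have "\<dots> \<le> t * (norm u + norm v)"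
      using a by (simp add: algebra_simps)
    also have "\<dots> \<le> t * K"
      using t K by (intro mult_left_mono) auto
    finally have b: "norm b \<le> t * K" .
    have a': "norm a \<le> t * K"
      using a mult_left_mono[of "norm u" K t] t K by linarith
    have R: "norm (R k) \<le> e' * (t * K)" if "norm k \<le> t * K" for k
      unfolding R_def using rem[of k] that tK e' mult_left_mono[of "norm k" "t * K" e'] by linarith
    have grad: "G (x + b) - G (x + a) = t *\<^sub>R G' v + (R b - R a)"
      by (simp add: R_def b_def G'.add G'.scaleR)
    have eq: "\<phi> 1 - \<phi> 0 - t\<^sup>2 * (u \<bullet> G' v) = t * (u \<bullet> (R b - R a))"
      unfolding mvt a_def[symmetric] add.assoc b_def[symmetric] grad
      by (simp add: inner_add_right algebra_simps power2_eq_square)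
    have "\<bar>u \<bullet> (R b - R a)\<bar> \<le> norm u * norm (R b - R a)"
      by (rule Cauchy_Schwarz_ineq2)
    also have "\<dots> \<le> K * (2 * (e' * (t * K)))"
      using K R[OF b] R[OF a'] norm_triangle_ineq4[of "R b" "R a"] by (intro mult_mono) auto
    also have "\<dots> = t * (e / 2)"
      using K by (simp add: e'_def field_simps)
    also have "\<dots> < t * e"
      using t \<open>e > 0\<close> by simp
    finally have "\<bar>u \<bullet> (R b - R a)\<bar> < t * e" .
    then have "\<bar>\<phi> 1 - \<phi> 0 - t\<^sup>2 * (u \<bullet> G' v)\<bar> < t\<^sup>2 * e"
      unfolding eq abs_mult using t by (simp add: power2_eq_square mult.assoc)
    moreover have "\<phi> 1 - \<phi> 0 =
        h (x + t *\<^sub>R u + t *\<^sub>R v) - h (x + t *\<^sub>R u) - h (x + t *\<^sub>R v) + h x"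
      by (simp add: \<phi>_def)
    moreover have "(\<phi> 1 - \<phi> 0) / t\<^sup>2 - u \<bullet> G' v = (\<phi> 1 - \<phi> 0 - t\<^sup>2 * (u \<bullet> G' v)) / t\<^sup>2"
      using t by (simp add: field_simps)
    ultimately show ?thesis
      using t by (simp add: dist_real_def field_simps)
  qed
  moreover have "0 < d / K"
    using d K by simp
  ultimately show "\<forall>\<^sub>F t in at_right 0.
      dist ((h (x + t *\<^sub>R u + t *\<^sub>R v) - h (x + t *\<^sub>R u) - h (x + t *\<^sub>R v) + h x) / t\<^sup>2)
        (u \<bullet> G' v) < e"
    unfolding eventually_at_right_field by blast
qed

lemma gradient_derivative_symmetric:
  fixes h :: "'a::real_inner \<Rightarrow> real"
  assumes "\<And>y. GDERIV h y :> G y" and "(G has_derivative G') (at x)"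
  shows "u \<bullet> G' v = v \<bullet> G' u"
proof -
  have "(\<lambda>t. (h (x + t *\<^sub>R v + t *\<^sub>R u) - h (x + t *\<^sub>R v) - h (x + t *\<^sub>R u) + h x) / t\<^sup>2) =
      (\<lambda>t. (h (x + t *\<^sub>R u + t *\<^sub>R v) - h (x + t *\<^sub>R u) - h (x + t *\<^sub>R v) + h x) / t\<^sup>2)"
    by (simp add: algebra_simps)
  then show ?thesis
    using second_difference_tendsto[OF assms, of u v] second_difference_tendsto[OF assms, of v u]
    by (auto intro: tendsto_unique[rotated])
qed

lemma hessian_symmetric:
  assumes "twice_differentiable h"
  shows "u \<bullet> (hessian h x *v v) = v \<bullet> (hessian h x *v u)"
  using assms gradient_derivative_symmetric[OF gradient_works hessian_works]
  unfolding twice_differentiable_def by blast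

section \<open>The smallest eigenvalue of a symmetric matrix\<close>

text \<open>Eigenvectors of a symmetric matrix for different eigenvalues are orthogonal, and a pairwise
  orthogonal set of nonzero vectors is linearly independent, hence finite.\<close>

lemma finite_real_eigenvalues:
  fixes A :: "real ^ 'n ^ 'n"
  assumes sym: "\<And>u v. u \<bullet> (A *v v) = v \<bullet> (A *v u)"
  shows "finite (real_eigenvalues A)"
proof -
  have "\<forall>l\<in>real_eigenvalues A. \<exists>v. v \<noteq> 0 \<and> A *v v = l *\<^sub>R v"
    by (simp add: real_eigenvalues_def)
  then obtain x where x: "\<And>l. l \<in> real_eigenvalues A \<Longrightarrow> x l \<noteq> 0 \<and> A *v x l = l *\<^sub>R x l"
    using bchoice by meson
  have orth: "x k \<bullet> x l = 0"
    if "k \<in> real_eigenvalues A" "l \<in> real_eigenvalues A" "k \<noteq> l" for k l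
  proof -
    have "l * (x k \<bullet> x l) = k * (x k \<bullet> x l)"
      using sym[of "x k" "x l"] x that by (simp add: inner_commute)
    then show ?thesis
      using that by simp
  qed
  have "inj_on x (real_eigenvalues A)"
    using orth x by (metis inj_onI inner_eq_zero_iff)
  moreover have "independent (x ` real_eigenvalues A)"
    using orth x by (intro pairwise_orthogonal_independent)
      (auto simp: pairwise_def orthogonal_def)
  then have "finite (x ` real_eigenvalues A)"
    by (rule independent_imp_finite)
  ultimately show ?thesis
    using finite_imageD by blast
qed

text \<open>A symmetric positive semidefinite form vanishes only on its kernel: otherwise the form would
  become negative on a line through \<open>u\<close>, where its linear term dominates.\<close>

lemma psd_form_zero_imp_kernel:
  fixes B :: "real ^ 'n ^ 'n"
  assumes sym: "\<And>u v. u \<bullet> (B *v v) = v \<bullet> (B *v u)"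
    and psd: "\<And>v. 0 \<le> v \<bullet> (B *v v)"
    and zero: "u \<bullet> (B *v u) = 0"
  shows "B *v u = 0"
proof (rule ccontr)
  assume neq: "B *v u \<noteq> 0"
  define r where "r = B *v u"
  define p where "p = r \<bullet> r"
  define q where "q = r \<bullet> (B *v r)"
  have p: "p > 0" and q: "q \<ge> 0"
    using neq psd by (auto simp: p_def q_def r_def)
  \<comment> \<open>The form at \<open>u - t *\<^sub>R r\<close> equals \<open>t * (t * q - 2 * p)\<close>, and this \<open>t\<close> makes \<open>t * q < p\<close>.\<close>
  define t where "t = p / (q + 1)"
  have t: "t > 0" and tq: "t * q < p"
    using p q by (auto simp: t_def field_simps)
  have "(u - t *\<^sub>R r) \<bullet> (B *v (u - t *\<^sub>R r)) =
      u \<bullet> (B *v u) - t * (u \<bullet> (B *v r)) - t * (r \<bullet> (B *v u)) + t * (t * q)"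
    by (simp add: matrix_vector_mult_diff_distrib matrix_vector_mult_scaleR inner_diff_left
        inner_diff_right q_def algebra_simps)
  also have "\<dots> = t * (t * q - 2 * p)"
    using zero sym[of u r] by (simp add: p_def r_def[symmetric] algebra_simps)
  also have "\<dots> < 0"
    using t tq p by (intro mult_pos_neg) auto
  finally show False
    using psd[of "u - t *\<^sub>R r"] by simp
qed

text \<open>The quadratic form attains a minimum \<open>m\<close> on the unit sphere. Subtracting \<open>m\<close> times the
  identity leaves a positive semidefinite form that vanishes at a minimizer, so the minimizer is
  an eigenvector for \<open>m\<close>.\<close>

lemma least_rayleigh_quotient_eigenvalue:
  fixes A :: "real ^ 'n ^ 'n"
  assumes sym: "\<And>u v. u \<bullet> (A *v v) = v \<bullet> (A *v u)"
  obtains m where "m \<in> real_eigenvalues A" and "\<And>v. m * (v \<bullet> v) \<le> v \<bullet> (A *v v)"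
proof -
  have "compact (sphere (0 :: real ^ 'n) 1)" "sphere (0 :: real ^ 'n) 1 \<noteq> {}"
    by auto
  moreover have "continuous_on (sphere 0 1) (\<lambda>v. v \<bullet> (A *v v))"
    by (intro continuous_intros matrix_vector_mult_linear_continuous_on)
  ultimately obtain u where u: "norm u = 1"
    and least: "\<And>v. norm v = 1 \<Longrightarrow> u \<bullet> (A *v u) \<le> v \<bullet> (A *v v)"
    using continuous_attains_inf[of "sphere 0 1" "\<lambda>v. v \<bullet> (A *v v)"] by auto
  define m where "m = u \<bullet> (A *v u)"
  have bound: "m * (v \<bullet> v) \<le> v \<bullet> (A *v v)" for v
  proof (cases "v = 0")
    case False
    define n where "n = norm v"
    have n: "n > 0" "v \<bullet> v = n\<^sup>2"
      using False by (simp_all add: n_def power2_norm_eq_inner)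
    have "m \<le> (v /\<^sub>R n) \<bullet> (A *v (v /\<^sub>R n))"
      unfolding m_def using n by (intro least) (simp add: n_def)
    also have "\<dots> = (v \<bullet> (A *v v)) / n\<^sup>2"
      by (simp add: matrix_vector_mult_scaleR power2_eq_square field_simps)
    finally show ?thesis
      using n by (simp add: field_simps)
  qed simp
  have B: "(A - m *\<^sub>R mat 1) *v v = A *v v - m *\<^sub>R v" for v
    by (simp add: matrix_vector_mult_diff_rdistrib scaleR_matrix_vector_assoc[symmetric])
  have "(A - m *\<^sub>R mat 1) *v u = 0"
  proof (rule psd_form_zero_imp_kernel)
    show "x \<bullet> ((A - m *\<^sub>R mat 1) *v y) = y \<bullet> ((A - m *\<^sub>R mat 1) *v x)" for x y
      using sym[of x y] by (simp add: B inner_diff_right inner_commute)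
    show "0 \<le> v \<bullet> ((A - m *\<^sub>R mat 1) *v v)" for v
      using bound[of v] by (simp add: B inner_diff_right)
    show "u \<bullet> ((A - m *\<^sub>R mat 1) *v u) = 0"
      using u m_def[symmetric] by (simp add: B inner_diff_right flip: power2_norm_eq_inner)
  qed
  then have "A *v u = m *\<^sub>R u"
    by (simp add: B)
  moreover have "u \<noteq> 0"
    using u by auto
  ultimately have "m \<in> real_eigenvalues A"
    unfolding real_eigenvalues_def by blast
  then show thesis
    using bound that by blast
qed

text \<open>Every eigenvalue is the Rayleigh quotient of its eigenvector, so any lower bound of the
  quotients is a lower bound of the eigenvalues; the least quotient is an eigenvalue itself.\<close>

lemma lambda_min_ge_iff:
  fixes A :: "real ^ 'n ^ 'n"
  assumes sym: "\<And>u v. u \<bullet> (A *v v) = v \<bullet> (A *v u)"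
  shows "lambda_min A \<ge> c \<longleftrightarrow> (\<forall>v. c * (v \<bullet> v) \<le> v \<bullet> (A *v v))"
proof -
  obtain m where m: "m \<in> real_eigenvalues A" and bound: "\<And>v. m * (v \<bullet> v) \<le> v \<bullet> (A *v v)"
    using least_rayleigh_quotient_eigenvalue[of A] sym by blast
  have below: "r \<le> l"
    if "l \<in> real_eigenvalues A" "\<forall>v. r * (v \<bullet> v) \<le> v \<bullet> (A *v v)" for r l
  proof -
    obtain v where "v \<noteq> 0" "A *v v = l *\<^sub>R v"
      using \<open>l \<in> real_eigenvalues A\<close> unfolding real_eigenvalues_def by blast
    moreover have "r * (v \<bullet> v) \<le> v \<bullet> (A *v v)"
      using that by blast
    ultimately show ?thesis
      by simp
  qed
  have "lambda_min A = m"
    unfolding lambda_min_def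
    using m bound below by (intro Min_eqI finite_real_eigenvalues sym) auto
  moreover have "c \<le> m \<longleftrightarrow> (\<forall>v. c * (v \<bullet> v) \<le> v \<bullet> (A *v v))"
    using below[OF m] bound by (meson inner_ge_zero mult_right_mono order_trans)
  ultimately show ?thesis
    by simp
qed

section \<open>Strong convexity and average Hessians\<close>

text \<open>Adding the convexity inequality to itself with the points exchanged shows that the gradient
  is strongly monotone; the Hessian bound is its infinitesimal form.\<close>

lemma strongly_convex_hessian_bound:
  assumes sc: "strongly_convex \<nu> f" and tw: "twice_differentiable f"
  shows "\<nu> * (v \<bullet> v) \<le> v \<bullet> (hessian f x *v v)"
proof -
  have "((\<lambda>t. gradient f (x + t *\<^sub>R v)) has_vector_derivative hessian f x *v v) (at 0)"
  proof -
    have "((\<lambda>t. x + t *\<^sub>R v) has_derivative (\<lambda>t. t *\<^sub>R v)) (at 0)"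
      by (auto intro!: derivative_eq_intros)
    from has_derivative_compose[OF this, of "gradient f" "\<lambda>k. hessian f x *v k"]
    show ?thesis
      using hessian_works[OF tw, of x]
      by (simp add: has_vector_derivative_def matrix_vector_mult_scaleR)
  qed
  then have "((\<lambda>t. v \<bullet> gradient f (x + t *\<^sub>R v)) has_field_derivative v \<bullet> (hessian f x *v v)) (at 0)"
    by (auto simp: has_vector_derivative_def has_field_derivative_def
        intro!: derivative_eq_intros)
  then have lim: "((\<lambda>t. (v \<bullet> gradient f (x + t *\<^sub>R v) - v \<bullet> gradient f x) / t)
      \<longlongrightarrow> v \<bullet> (hessian f x *v v)) (at_right 0)"
    unfolding DERIV_def by (auto intro: tendsto_mono[OF at_le])
  have "\<nu> * (v \<bullet> v) \<le> (v \<bullet> gradient f (x + t *\<^sub>R v) - v \<bullet> gradient f x) / t" if "t > 0" for t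
  proof -
    define y where "y = x + t *\<^sub>R v"
    have "f y \<ge> f x + gradient f x \<bullet> (y - x) + \<nu> / 2 * (norm (y - x))\<^sup>2"
      and "f x \<ge> f y + gradient f y \<bullet> (x - y) + \<nu> / 2 * (norm (x - y))\<^sup>2"
      using sc unfolding strongly_convex_def by blast+
    moreover have "y - x = t *\<^sub>R v" "x - y = - (t *\<^sub>R v)"
      by (simp_all add: y_def)
    ultimately have "\<nu> * (t\<^sup>2 * (v \<bullet> v)) \<le> t * (v \<bullet> gradient f y - v \<bullet> gradient f x)"
      unfolding power2_norm_eq_inner by (simp add: inner_commute algebra_simps power2_eq_square)
    then have "t * (t * (\<nu> * (v \<bullet> v))) \<le> t * (v \<bullet> gradient f y - v \<bullet> gradient f x)"
      by (simp add: power2_eq_square mult.commute mult.left_commute)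
    then have "t * (\<nu> * (v \<bullet> v)) \<le> v \<bullet> gradient f y - v \<bullet> gradient f x"
      using that by (simp only: mult_le_cancel_left_pos)
    then show ?thesis
      using that by (simp add: y_def pos_le_divide_eq mult.commute)
  qed
  then have "\<forall>\<^sub>F t in at_right 0.
      \<nu> * (v \<bullet> v) \<le> (v \<bullet> gradient f (x + t *\<^sub>R v) - v \<bullet> gradient f x) / t"
    by (auto simp: eventually_at_filter)
  with lim show ?thesis
    by (intro tendsto_lowerbound) auto
qed

lemma lipschitz_hessian_continuous:
  assumes "lipschitz_hessian L F"
  shows "continuous_on UNIV (hessian F)"
proof -
  have "continuous_on UNIV (\<lambda>x. hessian F x $ i $ j)" for i j
  proof (rule lipschitz_on_continuous_on[of "\<bar>L\<bar>"], rule lipschitz_onI)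
    fix x y
    have "\<bar>(hessian F x - hessian F y) $ i $ j\<bar> \<le> L * norm (x - y)"
      using matrix_component_le_onorm[of "hessian F x - hessian F y" i j] assms
      unfolding lipschitz_hessian_def by (meson order_trans)
    also have "\<dots> \<le> \<bar>L\<bar> * norm (x - y)"
      by (simp add: mult_right_mono)
    finally show "dist (hessian F x $ i $ j) (hessian F y $ i $ j) \<le> \<bar>L\<bar> * dist x y"
      by (simp add: dist_norm)
  qed simp
  then have "continuous_on UNIV (\<lambda>x. \<chi> i j. hessian F x $ i $ j)"
    by (intro continuous_on_vec_lambda)
  then show ?thesis
    by simp
qed

lemma continuous_hessian_avg_exists:
  assumes "continuous_on UNIV (hessian h)"
  shows "avg_hessian_exists h ws w"
  unfolding avg_hessian_exists_def
  by (intro integrable_continuous_interval continuous_on_compose2[OF assms])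
    (auto intro!: continuous_intros)

lemma avg_hessian_has_integral:
  fixes h :: "real ^ 'n \<Rightarrow> real"
  assumes "avg_hessian_exists h ws w"
  shows "((\<lambda>\<theta>. u \<bullet> (hessian h (\<theta> *\<^sub>R w + (1 - \<theta>) *\<^sub>R ws) *v v))
    has_integral u \<bullet> (avg_hessian h ws w *v v)) {0..1}"
proof -
  have "linear (\<lambda>A :: real ^ 'n ^ 'n. u \<bullet> (A *v v))"
    by (intro linearI)
      (simp_all add: matrix_vector_mult_add_rdistrib inner_add_right
        scaleR_matrix_vector_assoc[symmetric])
  then have "bounded_linear (\<lambda>A :: real ^ 'n ^ 'n. u \<bullet> (A *v v))"
    by (simp add: linear_conv_bounded_linear)
  from has_integral_linear[OF integrable_integral this]
  show ?thesis
    using assms unfolding avg_hessian_exists_def avg_hessian_def o_def by blast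
qed

lemma avg_hessian_symmetric:
  assumes "twice_differentiable h" and "avg_hessian_exists h ws w"
  shows "u \<bullet> (avg_hessian h ws w *v v) = v \<bullet> (avg_hessian h ws w *v u)"
  using avg_hessian_has_integral[OF assms(2), of u v] avg_hessian_has_integral[OF assms(2), of v u]
  unfolding hessian_symmetric[OF assms(1), of u _ v] by (rule has_integral_unique)

lemma strongly_convex_avg_hessian_bound:
  assumes "strongly_convex \<nu> f" and "twice_differentiable f" and "avg_hessian_exists f ws w"
  shows "\<nu> * (v \<bullet> v) \<le> v \<bullet> (avg_hessian f ws w *v v)"
proof -
  have "((\<lambda>\<theta>::real. \<nu> * (v \<bullet> v)) has_integral \<nu> * (v \<bullet> v)) {0..1}"
    using has_integral_const_real[of "\<nu> * (v \<bullet> v)" 0 1] by simp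
  then show ?thesis
    using avg_hessian_has_integral[OF assms(3)] strongly_convex_hessian_bound[OF assms(1,2)]
    by (rule has_integral_le)
qed

theorem lemma5:
  fixes F f g :: "real ^ 'n \<Rightarrow> real"
    and \<mu> L L\<^sub>H lam :: real
    and ws w :: "real ^ 'n"
  assumes "\<And>x. F x = f x + g x"
    and "twice_differentiable f"
    and "twice_differentiable g"
    and "PL \<mu> F"
    and "twice_differentiable F"
    and "L_smooth L F"
    and "lipschitz_hessian L\<^sub>H F"
    and "is_arg_min F (\<lambda>_. True) ws"
    and "lam > 0"
    and "strongly_convex (2 * lam) f"
    and "avg_hessian_exists g ws w"
    and "lambda_min (avg_hessian g ws w) \<ge> - lam"
  shows "average_out lam F ws w"
proof -
  have "F = (\<lambda>x. f x + g x)"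
    using assms(1) by blast
  then have hess: "hessian F x = hessian f x + hessian g x" for x
    using hessian_add[OF assms(2,3)] by simp
  have exF: "avg_hessian_exists F ws w"
    using continuous_hessian_avg_exists lipschitz_hessian_continuous assms(7) by blast
  have exf: "avg_hessian_exists f ws w"
    using integrable_diff[OF exF[unfolded avg_hessian_exists_def]
        assms(11)[unfolded avg_hessian_exists_def]]
    by (simp add: avg_hessian_exists_def hess)
  have avg: "avg_hessian F ws w = avg_hessian f ws w + avg_hessian g ws w"
    using exf assms(11) unfolding avg_hessian_exists_def avg_hessian_def hess
    by (rule integral_add)
  have "lam * (v \<bullet> v) \<le> v \<bullet> (avg_hessian F ws w *v v)" for v
  proof -
    have "2 * lam * (v \<bullet> v) \<le> v \<bullet> (avg_hessian f ws w *v v)"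
      using strongly_convex_avg_hessian_bound[OF assms(10,2) exf] .
    moreover have "- lam * (v \<bullet> v) \<le> v \<bullet> (avg_hessian g ws w *v v)"
      using assms(12) lambda_min_ge_iff[OF avg_hessian_symmetric[OF assms(3,11)]] by blast
    ultimately show ?thesis
      by (simp add: avg matrix_vector_mult_add_rdistrib inner_add_right)
  qed
  then have "lambda_min (avg_hessian F ws w) \<ge> lam"
    using lambda_min_ge_iff[OF avg_hessian_symmetric[OF assms(5) exF]] by blast
  then show ?thesis
    using assms(9) by (simp add: average_out_def)
qed

end
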